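(* Let $S$ be an oriented $C^1$ surface in $\mathbb{R}^3$ whose normal line congruence is parameterized by $\xi=\xi_0(\mu,\bar\mu)$, $\eta=\eta_0(\mu,\bar\mu)$, $r=r_0(\mu,\bar\mu)$. Hamilton's mixed characteristic function for reflection in $S$ is \[ W((z_1,t_1),\xi_2)=\pm\left|\frac{\bar{\xi}_1z_1+\xi_1\bar{z}_1+(1-\xi_1\bar{\xi}_1)t_1}{1+\xi_1\bar{\xi}_1}+\frac{2|\xi_1-\xi_2|}{\left[(1+\xi_1\bar{\xi}_1)(1+\xi_2\bar{\xi}_2)\right]^{\frac12}}\,r_0\right|, \] where \[ \xi_1=\frac{2\xi_0\bar{\xi}_2+1-\xi_0\bar{\xi}_0}{(1-\xi_0\bar{\xi}_0)\bar{\xi}_2-2\bar{\xi}_0}, \] and $\xi_0=\xi_0(\mu,\bar\mu)\in\pi_1\circ\Phi_S^{-1}(S)$ (with corresponding $\eta_0=\eta_0(\mu,\bar\mu)$, $r_0=r_0(\mu,\bar\mu)$) is a solution of \begin{align*} z_1[(1-\xi_0\bar{\xi}_0)\bar{\xi}_2-2\bar{\xi}_0]^2&-2t_1[(1-\xi_0\bar{\xi}_0)\bar{\xi}_2-2\bar{\xi}_0][2\xi_0\bar{\xi}_2+1-\xi_0\bar{\xi}_0]-\bar{z}_1[2\xi_0\bar{\xi}_2+1-\xi_0\bar{\xi}_0]^2\\ &=2\left((\bar{\xi}_0-\bar{\xi}_2)^2\eta_0-(1+\xi_0\bar{\xi}_2)^2\bar{\eta}_0+(\bar{\xi}_0-\bar{\xi}_2)(1+\xi_0\bar{\xi}_2)(1+\xi_0\bar{\xi}_0)r_0\right).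 \end{align*}
   Context: Oriented lines: $\mathbb{L}$ is the set of oriented affine lines in Euclidean $\mathbb{R}^3$, identified with the tangent bundle of the unit sphere $S^2=\mathbb{P}^1$. A direction (unit vector $v$) is described by the complex coordinate $\xi=\tan(\theta/2)e^{i\phi}$ (stereographic projection from the south pole), so $v_1+iv_2=\frac{2\xi}{1+\xi\bar\xi}$, $v_3=\frac{1-\xi\bar\xi}{1+\xi\bar\xi}$; throughout one works in the patch omitting the south direction. An oriented line has coordinates $(\xi,\eta)\in\mathbb{C}^2$, where $\xi$ is its direction and the tangent vector $\eta\,\partial_\xi+\bar\eta\,\partial_{\bar\xi}$ represents the perpendicular vector from the origin to the line. Write points of $\mathbb{R}^3$ as $(z,t)$ with $z=x^1+ix^2$, $t=x^3$. The map $\Phi:\mathbb{L}\times\mathbb{R}\to\mathbb{R}^3$ sends $((\xi,\eta),r)$ to the point on the line $(\xi,\eta)$ at signed affine parameter distance $r$ from the point of the line closest to the origin: \[ z=\frac{2(\eta-\bar\eta\xi^2)+2\xi(1+\xi\bar\xi)r}{(1+\xi\bar\xi)^2},\qquad t=\frac{-2(\eta\bar\xi+\bar\eta\xi)+(1-\xi^2\bar\xi^2)r}{(1+\xi\bar\xi)^2}. \] The map $\pi_1:\mathbb{L}\times\mathbb{R}\to\mathbb{P}^1$ is $((\xi,\eta),r)\mapsto\xi$. Surfaces: for an oriented $C^1$ surface $S\subset\mathbb{R}^3$, $\Phi_S^{-1}:S\to\mathbb{L}\times\mathbb{R}$ sends $p\in S$ to the oriented normal line $(\xi_0,\eta_0)$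 to $S$ at $p$ together with the (signed) distance $r_0$ of $p$ from the point on that normal line closest to the origin. Thus $\pi_1\circ\Phi_S^{-1}$ is the Gauss map of $S$. The normal congruence of $S$ is parameterized locally by a complex parameter $\mu$: $\xi_0(\mu,\bar\mu)$, $\eta_0(\mu,\bar\mu)$, $r_0(\mu,\bar\mu)$. Reflection: an oriented line with unit direction $v$ meeting $S$ at a point $p$ with unit normal $n$ is reflected to the oriented line through $p$ with direction $v-2(v\cdot n)n$. In coordinates, the incoming direction $\xi_1$, the normal direction $\xi_0$ and the reflected direction $\xi_2$ are related by $\xi_2=\frac{2\xi_0\bar\xi_1+1-\xi_0\bar\xi_0}{(1-\xi_0\bar\xi_0)\bar\xi_1-2\bar\xi_0}$. Mixed characteristic function: for an incoming ray $(\xi_1,\eta_1)$ through the point $p_1=(z_1,t_1)$ that is reflected in $S$ to $(\xi_2,\eta_2)$, let $q_2$ be the point on the reflected ray closest to the origin. $W$ takes the point $p_1$ and the direction $\xi_2$ to the distance along the rays between $p_1$ and $q_2$ (via the reflection point). Points such as $q_2$ may lie on the opposite side of the surface, at points which the light never physically passes through; the associated distances are then counted negatively. $W$ is defined only for those $(p_1,\xi_2)$ for which such a ray exists, and may be multivalued, since there may be more than one such ray. The sign $\pm$ is an overall sign.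
   Formalization: Only reflections on the side to which the orientation of S points are considered: the incoming direction satisfies v·n ≤ 0, both for the rays defining W and for the solutions ξ_0; for v·n > 0 the stated formula fails, since r_0 would need the opposite sign. *)

theory Defs
  imports "HOL-Analysis.Analysis"
begin

(* Euclidean 3-space in the coordinates (z,t), z = x1 + i x2, t = x3.  The inner product and
   norm of complex \<times> real are the Euclidean ones in (x1,x2,x3). *)
type_synonym space = "complex \<times> real"

(* Coordinates (\<xi>,\<eta>) of an oriented line; the direction (0,-1) is omitted by the patch. *)
type_synonym oriented_line = "complex \<times> complex"

(* In this and the next definition the argument of Re is a real number. *)
definition direction :: "complex \<Rightarrow> space" where
  "direction \<xi> = (2 * \<xi> / (1 + \<xi> * cnj \<xi>), Re ((1 - \<xi> * cnj \<xi>) / (1 + \<xi> * cnj \<xi>)))"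

fun Phi :: "oriented_line \<times> real \<Rightarrow> space" where
  "Phi ((\<xi>, \<eta>), r) =
     ((2 * (\<eta> - cnj \<eta> * \<xi>\<^sup>2) + 2 * \<xi> * (1 + \<xi> * cnj \<xi>) * of_real r) / (1 + \<xi> * cnj \<xi>)\<^sup>2,
      Re ((- 2 * (\<eta> * cnj \<xi> + cnj \<eta> * \<xi>) + (1 - \<xi>\<^sup>2 * (cnj \<xi>)\<^sup>2) * of_real r)
            / (1 + \<xi> * cnj \<xi>)\<^sup>2))"

definition line_points :: "oriented_line \<Rightarrow> space set" where
  "line_points l = range (\<lambda>r. Phi (l, r))"

lemma one_plus_cnj_nonzero: "1 + \<xi> * cnj \<xi> \<noteq> 0"
proof -
  have "0 < 1 + (cmod \<xi>)\<^sup>2"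
    by (simp add: add_pos_nonneg)
  moreover have "1 + \<xi> * cnj \<xi> = of_real (1 + (cmod \<xi>)\<^sup>2)"
    by (simp add: complex_norm_square [symmetric] del: of_real_power)
  ultimately show ?thesis
    by (metis less_irrefl of_real_eq_0_iff)
qed

lemma Phi_affine: "Phi ((\<xi>, \<eta>), r) = Phi ((\<xi>, \<eta>), 0) + r *\<^sub>R direction \<xi>"
proof -
  define d where "d = 1 + \<xi> * cnj \<xi>"
  have d: "d \<noteq> 0" unfolding d_def by (rule one_plus_cnj_nonzero)
  have 1: "(A + 2 * \<xi> * d * of_real r) / d\<^sup>2 = A / d\<^sup>2 + of_real r * (2 * \<xi> / d)" for A
    using d by (simp add: add_divide_distrib power2_eq_square)
  have f: "1 - \<xi>\<^sup>2 * (cnj \<xi>)\<^sup>2 = (1 - \<xi> * cnj \<xi>) * d"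
    by (simp add: d_def algebra_simps power2_eq_square)
  have "(B + (1 - \<xi>\<^sup>2 * (cnj \<xi>)\<^sup>2) * of_real r) / d\<^sup>2
      = B / d\<^sup>2 + of_real r * ((1 - \<xi> * cnj \<xi>) / d)" for B
    unfolding f using d by (simp add: add_divide_distrib power2_eq_square)
  then have 2: "Re ((B + (1 - \<xi>\<^sup>2 * (cnj \<xi>)\<^sup>2) * of_real r) / d\<^sup>2)
      = Re (B / d\<^sup>2) + r * Re ((1 - \<xi> * cnj \<xi>) / d)" for B
    by (simp only: plus_complex.simps Re_complex_of_real times_complex.simps Im_complex_of_real)
  show ?thesis
    unfolding Phi.simps direction_def d_def [symmetric] 1 2
    by (simp add: scaleR_conv_of_real)
qed

(* An embedded surface of class C^1, given by local parametrisations f, together with a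
   continuous unit normal field N. *)
definition oriented_C1_surface :: "space set \<Rightarrow> (space \<Rightarrow> space) \<Rightarrow> bool" where
  "oriented_C1_surface S N \<longleftrightarrow>
     continuous_on S N \<and> (\<forall>p\<in>S. norm (N p) = 1) \<and>
     (\<forall>p\<in>S. \<exists>(U :: complex set) (f :: complex \<Rightarrow> space) (f' :: complex \<Rightarrow> complex \<Rightarrow>\<^sub>L space) g.
        open U \<and> p \<in> f ` U \<and> openin (top_of_set S) (f ` U) \<and>
        homeomorphism U (f ` U) f g \<and>
        (\<forall>u\<in>U. (f has_derivative blinfun_apply (f' u)) (at u)) \<and> continuous_on U f' \<and>
        (\<forall>u\<in>U. inj (blinfun_apply (f' u)) \<and>
                (\<forall>h. N (f u) \<bullet> blinfun_apply (f' u) h = 0)))"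

(* The oriented normal line at p with the position of p on it.  The value is unique, and it
   exists unless N p = (0,-1). *)
definition Phi_S_inv :: "(space \<Rightarrow> space) \<Rightarrow> space \<Rightarrow> oriented_line \<times> real" where
  "Phi_S_inv N p = (THE x. direction (fst (fst x)) = N p \<and> Phi x = p)"

(* No injectivity is required, and M need not be connected: a union of disjoint coordinate
   domains parametrises a surface that is not covered by a single chart. *)
definition parameterizes_normal_congruence ::
  "space set \<Rightarrow> (space \<Rightarrow> space) \<Rightarrow> complex set \<Rightarrow>
   (complex \<Rightarrow> complex) \<Rightarrow> (complex \<Rightarrow> complex) \<Rightarrow> (complex \<Rightarrow> real) \<Rightarrow> bool" where
  "parameterizes_normal_congruence S N M \<xi>0 \<eta>0 r0 \<longleftrightarrow>
     open M \<and> continuous_on M \<xi>0 \<and> continuous_on M \<eta>0 \<and> continuous_on M r0 \<and>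
     (\<lambda>\<mu>. ((\<xi>0 \<mu>, \<eta>0 \<mu>), r0 \<mu>)) ` M = Phi_S_inv N ` S"

definition reflect :: "space \<Rightarrow> space \<Rightarrow> space" where
  "reflect n v = v - (2 * (v \<bullet> n)) *\<^sub>R n"

(* The line l1 meets S at p and is reflected there to l2.  The reflecting side of the oriented
   surface is the one N points to, so an incoming direction has non-positive product with N p. *)
definition reflected_in ::
  "space set \<Rightarrow> (space \<Rightarrow> space) \<Rightarrow> oriented_line \<Rightarrow> space \<Rightarrow> oriented_line \<Rightarrow> bool" where
  "reflected_in S N l1 p l2 \<longleftrightarrow>
     p \<in> S \<and> p \<in> line_points l1 \<and> p \<in> line_points l2 \<and>
     direction (fst l1) \<bullet> N p \<le> 0 \<and>
     direction (fst l2) = reflect (N p) (direction (fst l1))"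

(* Distance from a to b, both on a line with unit direction v, counted negatively when b lies
   behind a. *)
definition ray_distance :: "space \<Rightarrow> space \<Rightarrow> space \<Rightarrow> real" where
  "ray_distance v a b = (b - a) \<bullet> v"

(* The set of values of W at (p1, \<xi>2): W may be multivalued, and the set is empty where W is
   not defined. *)
definition mixed_characteristic ::
  "space set \<Rightarrow> (space \<Rightarrow> space) \<Rightarrow> space \<Rightarrow> complex \<Rightarrow> real set" where
  "mixed_characteristic S N p1 \<xi>2 =
     {ray_distance (direction \<xi>1) p1 p + ray_distance (direction \<xi>2) p q2 | \<xi>1 \<eta>1 \<eta>2 p q2.
        p1 \<in> line_points (\<xi>1, \<eta>1) \<and> reflected_in S N (\<xi>1, \<eta>1) p (\<xi>2, \<eta>2) \<and>
        q2 = closest_point (line_points (\<xi>2, \<eta>2)) 0}"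

end

theory Submission
  imports Defs
begin

text \<open>
  Let \<open>v1\<close> and \<open>v2\<close> be the unit directions of the incoming and the reflected ray, \<open>n\<close> the unit normal at
  the point of reflection \<open>p\<close>, and \<open>q2\<close> the point of the reflected line closest to the origin. Since
  \<open>q2\<close> is orthogonal to \<open>v2\<close>, the path length from \<open>p1\<close> to \<open>q2\<close> is
  \<open>(p - p1) \<bullet> v1 - p \<bullet> v2 = - p1 \<bullet> v1 + p \<bullet> (v1 - v2)\<close>.
  By the law of reflection \<open>v1 - v2\<close> is \<open>2 (v1 \<bullet> n) n\<close>, and \<open>v1 \<bullet> n \<le> 0\<close> because the light comes from the
  side to which \<open>n\<close> points. Hence \<open>v1 - v2 = - \<bar>v1 - v2\<bar> n\<close>, and with \<open>r0 = p \<bullet> n\<close> the length is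
  \<open>- (p1 \<bullet> v1 + \<bar>v1 - v2\<bar> r0)\<close> (\<open>path_length_by_reflection\<close>). In the stereographic coordinate the chord
  \<open>\<bar>v1 - v2\<bar>\<close> and the product \<open>p1 \<bullet> v1\<close> become the two summands of the formula
  (\<open>norm_direction_diff\<close>, \<open>of_real_inner_direction\<close>).

  It remains to see that the points of reflection correspond to the solutions of the stated equation.
  Reflection is an involution, so \<open>v1\<close> is the mirror image of \<open>v2\<close>; in homogeneous coordinates on the
  sphere this mirror image is the pair of numerator and denominator of \<open>\<xi>1\<close>, and the denominator vanishes
  exactly when \<open>v1\<close> is the omitted south direction (\<open>direction_reflect_iff\<close>). The equation then says
  that \<open>p1\<close> and \<open>p\<close> lie on one common line of direction \<open>\<xi>1\<close>: the line of direction \<open>\<xi>\<close> through \<open>(z, t)\<close> has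
  \<open>2 \<eta> = z - 2 t \<xi> - cnj z \<xi>\<^sup>2\<close> (\<open>in_line_points_iff\<close>), and the two sides of the equation are this
  expression for \<open>p1\<close> and for \<open>p\<close>, multiplied by the squared denominator of \<open>\<xi>1\<close>
  (\<open>line_coordinate_divide\<close>, \<open>line_coordinate_divide_Phi\<close>).

  The coordinate identities are rational identities in complex numbers and their conjugates. They are
  proved with the conjugates replaced by independent variables, as identities between polynomials after
  clearing denominators.
\<close>

section \<open>Directions in the stereographic coordinate\<close>

text \<open>
  Points of the form \<open>Phi (l, r)\<close> are handled through their properties; the formula behind them is
  needed only in a few computations.
\<close>

declare Phi.simps [simp del]

lemma of_real_Re_self_conjugate:
  assumes "cnj w = w" shows "complex_of_real (Re w) = w"
  using assms by (simp add: Reals_cnj_iff)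

lemma of_real_inner_space:
  "complex_of_real ((z, t) \<bullet> (w, s)) = (z * cnj w + cnj z * w) / 2 + of_real t * of_real s"
  by (simp add: complex_eq_iff inner_complex_def)

text \<open>
  Third coordinates are real parts of quotients that are in fact real. Seen in the complex numbers the
  real part disappears, and identities about points of space become algebraic.
\<close>

lemma of_real_snd_direction:
  "complex_of_real (snd (direction \<xi>)) = (1 - \<xi> * cnj \<xi>) / (1 + \<xi> * cnj \<xi>)"
  unfolding direction_def snd_conv
  by (rule of_real_Re_self_conjugate) (simp add: mult.commute)

lemma cnj_fst_Phi:
  "cnj (fst (Phi ((\<xi>, \<eta>), r)))
     = (2 * (cnj \<eta> - \<eta> * (cnj \<xi>)\<^sup>2) + 2 * cnj \<xi> * (1 + \<xi> * cnj \<xi>) * of_real r) / (1 + \<xi> * cnj \<xi>)\<^sup>2"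
  by (simp add: Phi.simps mult.commute)

lemma of_real_snd_Phi:
  "complex_of_real (snd (Phi ((\<xi>, \<eta>), r)))
     = (- 2 * (\<eta> * cnj \<xi> + cnj \<eta> * \<xi>) + (1 - \<xi>\<^sup>2 * (cnj \<xi>)\<^sup>2) * of_real r) / (1 + \<xi> * cnj \<xi>)\<^sup>2"
  unfolding Phi.simps snd_conv
  by (rule of_real_Re_self_conjugate) (simp add: algebra_simps)

lemma inner_direction_algebra:
  fixes z w t a b k d :: complex
  shows "(z * (2 * a / d) + w * (2 * b / d)) / 2 + t * (k / d) = (a * z + b * w + k * t) / d"
  by (cases "d = 0") (simp_all add: field_simps)

lemma of_real_inner_direction:
  "complex_of_real ((z, t) \<bullet> direction \<xi>)
     = (cnj \<xi> * z + \<xi> * cnj z + (1 - \<xi> * cnj \<xi>) * of_real t) / (1 + \<xi> * cnj \<xi>)"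
proof -
  have "complex_of_real ((z, t) \<bullet> direction \<xi>)
      = (z * cnj (fst (direction \<xi>)) + cnj z * fst (direction \<xi>)) / 2
        + of_real t * of_real (snd (direction \<xi>))"
    using of_real_inner_space[of z t "fst (direction \<xi>)" "snd (direction \<xi>)"] by simp
  also have "\<dots> = (z * (2 * cnj \<xi> / (1 + \<xi> * cnj \<xi>)) + cnj z * (2 * \<xi> / (1 + \<xi> * cnj \<xi>))) / 2
        + of_real t * ((1 - \<xi> * cnj \<xi>) / (1 + \<xi> * cnj \<xi>))"
    unfolding of_real_snd_direction by (simp add: direction_def mult.commute)
  also have "\<dots> = (cnj \<xi> * z + \<xi> * cnj z + (1 - \<xi> * cnj \<xi>) * of_real t) / (1 + \<xi> * cnj \<xi>)"
    by (rule inner_direction_algebra)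
  finally show ?thesis .
qed

lemma of_real_inner_directions:
  "complex_of_real (direction y \<bullet> direction x)
     = (cnj x * (2 * y / (1 + y * cnj y)) + x * (2 * cnj y / (1 + y * cnj y))
        + (1 - x * cnj x) * ((1 - y * cnj y) / (1 + y * cnj y))) / (1 + x * cnj x)"
proof -
  have "complex_of_real (direction y \<bullet> direction x)
      = complex_of_real ((fst (direction y), snd (direction y)) \<bullet> direction x)"
    by simp
  also have "\<dots> = (cnj x * (2 * y / (1 + y * cnj y)) + x * (2 * cnj y / (1 + y * cnj y))
        + (1 - x * cnj x) * ((1 - y * cnj y) / (1 + y * cnj y))) / (1 + x * cnj x)"
    unfolding of_real_inner_direction of_real_snd_direction by (simp add: direction_def mult.commute)
  finally show ?thesis .
qed

lemma norm_direction: "norm (direction \<xi>) = 1"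
proof -
  have d: "1 + \<xi> * cnj \<xi> \<noteq> 0" by (rule one_plus_cnj_nonzero)
  have "complex_of_real (direction \<xi> \<bullet> direction \<xi>) = 1"
    using of_real_inner_direction[of "fst (direction \<xi>)" "snd (direction \<xi>)" \<xi>] d
    by (simp add: of_real_snd_direction)
       (simp add: direction_def divide_simps mult.commute, simp add: algebra_simps)
  then show ?thesis by (simp add: norm_eq_sqrt_inner)
qed

text \<open>
  This is the denominator of the stereographic projection from the south pole: it is nonzero on every
  direction of the patch, and dividing the first component by it recovers the coordinate.
\<close>

lemma one_plus_snd_direction:
  "1 + complex_of_real (snd (direction \<xi>)) = 2 / (1 + \<xi> * cnj \<xi>)"
  using one_plus_cnj_nonzero[of \<xi>] by (simp add: of_real_snd_direction field_simps)

lemma inj_direction: "inj direction"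
proof (rule inj_on_inverseI)
  fix \<xi>
  show "fst (direction \<xi>) / (1 + complex_of_real (snd (direction \<xi>))) = \<xi>"
    using one_plus_cnj_nonzero[of \<xi>]
    unfolding one_plus_snd_direction by (simp add: direction_def)
qed

lemma direction_neq_south: "direction \<xi> \<noteq> (0, - 1)"
proof
  assume "direction \<xi> = (0, - 1)"
  then have "2 / (1 + \<xi> * cnj \<xi>) = 0"
    using one_plus_snd_direction[of \<xi>] by simp
  then show False using one_plus_cnj_nonzero[of \<xi>] by simp
qed

lemma direction_exhausts_unit_vectors:
  assumes "norm v = 1" and "v \<noteq> (0, - 1)"
  obtains \<xi> where "direction \<xi> = v"
proof -
  obtain z t where v: "v = (z, t)" by (cases v)
  have "v \<bullet> v = 1" using assms(1) by (simp add: norm_eq_1)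
  then have zt: "z \<bullet> z + t * t = 1" by (simp add: v)
  have t: "1 + t \<noteq> 0"
  proof
    assume "1 + t = 0"
    then have "t = - 1" by simp
    with zt have "z = 0" by simp
    with \<open>t = - 1\<close> assms(2) v show False by simp
  qed
  then have T: "1 + complex_of_real t \<noteq> 0" by (metis of_real_1 of_real_add of_real_eq_0_iff)
  have "complex_of_real (v \<bullet> v) = 1" using \<open>v \<bullet> v = 1\<close> by simp
  then have Z: "z * cnj z = 1 - (of_real t)\<^sup>2"
    unfolding v of_real_inner_space by (simp add: power2_eq_square algebra_simps)
  define \<xi> where "\<xi> = z / (1 + complex_of_real t)"
  have n: "\<xi> * cnj \<xi> = (1 - of_real t) / (1 + of_real t)"
  proof -
    have "\<xi> * cnj \<xi> = ((1 + of_real t) * (1 - of_real t)) / ((1 + of_real t) * (1 + of_real t))"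
      using Z by (simp add: \<xi>_def power2_eq_square algebra_simps)
    then show ?thesis by (simp only: mult_divide_mult_cancel_left[OF T])
  qed
  have D: "1 + \<xi> * cnj \<xi> = 2 / (1 + of_real t)"
    unfolding n using T by (simp add: field_simps)
  have "fst (direction \<xi>) = z"
    unfolding direction_def D using T by (simp add: \<xi>_def)
  moreover have "complex_of_real (snd (direction \<xi>)) = of_real t"
  proof -
    have "1 - \<xi> * cnj \<xi> = 2 * of_real t / (1 + of_real t)"
      unfolding n using T by (simp add: field_simps)
    then show ?thesis unfolding of_real_snd_direction D using T by simp
  qed
  ultimately have "direction \<xi> = v" by (simp add: v prod_eq_iff)
  then show thesis by (rule that)
qed

section \<open>Oriented lines and the points on them\<close>

text \<open>
  The coordinate \<open>\<eta>\<close> of the line of direction \<open>\<xi>\<close> through the given point.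
\<close>

definition line_coordinate :: "complex \<Rightarrow> space \<Rightarrow> complex" where
  "line_coordinate \<xi> p
     = (fst p - 2 * of_real (snd p) * \<xi> - cnj (fst p) * \<xi>\<^sup>2) / 2"

text \<open>
  Here and in \<open>Phi_inverse_algebra\<close>, \<open>y\<close> stands for \<open>cnj x\<close>, \<open>w\<close> for \<open>cnj z\<close> and \<open>f\<close> for \<open>cnj e\<close>. The
  variables \<open>e\<close> and \<open>r\<close> are the coordinate \<open>\<eta>\<close> and the affine parameter of the point \<open>(z, t)\<close>.
\<close>

lemma Phi_coordinates_algebra:
  fixes x y z w t :: complex
  assumes "1 + x * y \<noteq> 0"
  defines "e \<equiv> (z - 2*t*x - w*x\<^sup>2)/2" and "f \<equiv> (w - 2*t*y - z*y\<^sup>2)/2"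
    and "r \<equiv> (y*z+x*w+(1-x*y)*t)/(1+x*y)"
  shows "(2 * (e - f * x\<^sup>2) + 2 * x * (1 + x * y) * r) / (1 + x * y)\<^sup>2 = z"
    and "(- 2 * (e * y + f * x) + (1 - x\<^sup>2 * y\<^sup>2) * r) / (1 + x * y)\<^sup>2 = t"
proof -
  have R: "(1 + x * y) * r = y*z+x*w+(1-x*y)*t" using assms by (simp add: r_def)
  have E: "2*e = z - 2*t*x - w*x\<^sup>2" "2*f = w - 2*t*y - z*y\<^sup>2" by (simp_all add: e_def f_def)
  show "(2 * (e - f * x\<^sup>2) + 2 * x * (1 + x * y) * r) / (1 + x * y)\<^sup>2 = z"
    using assms(1) R E by (simp add: divide_eq_eq) algebra
  show "(- 2 * (e * y + f * x) + (1 - x\<^sup>2 * y\<^sup>2) * r) / (1 + x * y)\<^sup>2 = t"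
    using assms(1) R E by (simp add: divide_eq_eq) algebra
qed

lemma Phi_coordinates: "Phi ((\<xi>, line_coordinate \<xi> p), p \<bullet> direction \<xi>) = p"
proof -
  obtain z t where p: "p = (z, t)" by (cases p)
  note d = one_plus_cnj_nonzero[of \<xi>]
  have c: "cnj (line_coordinate \<xi> p) = (cnj z - 2 * of_real t * cnj \<xi> - z * (cnj \<xi>)\<^sup>2) / 2"
    by (simp add: line_coordinate_def p)
  have "fst (Phi ((\<xi>, line_coordinate \<xi> p), p \<bullet> direction \<xi>)) = z"
    unfolding Phi.simps fst_conv c unfolding p of_real_inner_direction line_coordinate_def fst_conv snd_conv
    by (rule Phi_coordinates_algebra(1)[OF d])
  moreover have "complex_of_real (snd (Phi ((\<xi>, line_coordinate \<xi> p), p \<bullet> direction \<xi>))) = of_real t"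
    unfolding of_real_snd_Phi c unfolding p of_real_inner_direction line_coordinate_def fst_conv snd_conv
    by (rule Phi_coordinates_algebra(2)[OF d])
  ultimately show ?thesis by (simp add: p prod_eq_iff)
qed

text \<open>
  The converse substitution. The last identity is the one behind the equation of the theorem: its left
  side is the \<open>\<eta>\<close>-expression \<open>z - 2 t a - w a\<^sup>2\<close> made homogeneous, at the direction that arises by
  reflecting the direction with conjugate coordinate \<open>s\<close> in the plane orthogonal to the direction \<open>x\<close>.
\<close>

lemma Phi_inverse_algebra:
  fixes x y e f r :: complex
  assumes "1 + x * y \<noteq> 0"
  defines "z \<equiv> (2 * (e - f * x\<^sup>2) + 2 * x * (1 + x * y) * r) / (1 + x * y)\<^sup>2"
    and "w \<equiv> (2 * (f - e * y\<^sup>2) + 2 * y * (1 + x * y) * r) / (1 + x * y)\<^sup>2"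
    and "t \<equiv> (- 2 * (e * y + f * x) + (1 - x\<^sup>2 * y\<^sup>2) * r) / (1 + x * y)\<^sup>2"
  shows "2 * e = z - 2*t*x - w*x\<^sup>2"
    and "r * (1+x*y) = y*z+x*w+(1-x*y)*t"
    and "z * ((1 - x * y) * s - 2 * y)\<^sup>2 - 2 * t * ((1 - x * y) * s - 2 * y) * (2 * x * s + 1 - x * y)
           - w * (2 * x * s + 1 - x * y)\<^sup>2
         = 2 * ((y - s)\<^sup>2 * e - (1 + x * s)\<^sup>2 * f + (y - s) * (1 + x * s) * (1 + x * y) * r)"
proof -
  define D where "D = (1 + x * y)\<^sup>2"
  have D: "D \<noteq> 0" using assms by (simp add: D_def)
  have E: "D * z = 2 * (e - f * x\<^sup>2) + 2 * x * (1 + x * y) * r"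
    "D * w = 2 * (f - e * y\<^sup>2) + 2 * y * (1 + x * y) * r"
    "D * t = - 2 * (e * y + f * x) + (1 - x\<^sup>2 * y\<^sup>2) * r"
    using D by (simp_all add: z_def w_def t_def D_def)
  have "D * (2 * e) = D * (z - 2*t*x - w*x\<^sup>2)" using E D_def by algebra
  with D show "2 * e = z - 2*t*x - w*x\<^sup>2" by simp
  have "D * (r * (1+x*y)) = D * (y*z+x*w+(1-x*y)*t)" using E D_def by algebra
  with D show "r * (1+x*y) = y*z+x*w+(1-x*y)*t" by simp
  have "D * (z * ((1 - x * y) * s - 2 * y)\<^sup>2 - 2 * t * ((1 - x * y) * s - 2 * y) * (2 * x * s + 1 - x * y)
           - w * (2 * x * s + 1 - x * y)\<^sup>2)
         = D * (2 * ((y - s)\<^sup>2 * e - (1 + x * s)\<^sup>2 * f + (y - s) * (1 + x * s) * (1 + x * y) * r))"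
    using E D_def by algebra
  with D show "z * ((1 - x * y) * s - 2 * y)\<^sup>2 - 2 * t * ((1 - x * y) * s - 2 * y) * (2 * x * s + 1 - x * y)
           - w * (2 * x * s + 1 - x * y)\<^sup>2
         = 2 * ((y - s)\<^sup>2 * e - (1 + x * s)\<^sup>2 * f + (y - s) * (1 + x * s) * (1 + x * y) * r)" by simp
qed

lemma inner_Phi_direction: "Phi ((\<xi>, \<eta>), r) \<bullet> direction \<xi> = r"
proof -
  have "complex_of_real (Phi ((\<xi>, \<eta>), r) \<bullet> direction \<xi>)
      = complex_of_real ((fst (Phi ((\<xi>, \<eta>), r)), snd (Phi ((\<xi>, \<eta>), r))) \<bullet> direction \<xi>)"
    by simp
  also have "\<dots> = of_real r"
    unfolding of_real_inner_direction of_real_snd_Phi cnj_fst_Phi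
    unfolding Phi.simps fst_conv
      Phi_inverse_algebra(2)[OF one_plus_cnj_nonzero[of \<xi>], of "of_real r" \<eta> "cnj \<eta>", symmetric]
    using one_plus_cnj_nonzero[of \<xi>] by simp
  finally show ?thesis by (simp only: of_real_eq_iff)
qed

lemma line_coordinate_Phi: "line_coordinate \<xi> (Phi ((\<xi>, \<eta>), r)) = \<eta>"
proof -
  show ?thesis
    unfolding line_coordinate_def of_real_snd_Phi cnj_fst_Phi
    unfolding Phi.simps fst_conv
      Phi_inverse_algebra(1)[OF one_plus_cnj_nonzero[of \<xi>], of \<eta> "cnj \<eta>" "of_real r", symmetric]
    by simp
qed

lemma in_line_points_iff: "p \<in> line_points (\<xi>, \<eta>) \<longleftrightarrow> \<eta> = line_coordinate \<xi> p"
  unfolding line_points_def using line_coordinate_Phi Phi_coordinates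
  by (metis (no_types, lifting) imageE rangeI)

text \<open>
  The point with parameter \<open>0\<close> is orthogonal to the direction, so by Pythagoras it is the one and only
  point of the line at minimal distance from the origin.
\<close>

lemma closest_point_line_points:
  "closest_point (line_points (\<xi>, \<eta>)) 0 = Phi ((\<xi>, \<eta>), 0)"
proof -
  define q where "q = Phi ((\<xi>, \<eta>), 0)"
  have n: "(norm (Phi ((\<xi>, \<eta>), r)))\<^sup>2 = (norm q)\<^sup>2 + r\<^sup>2" for r
  proof -
    have "q \<bullet> direction \<xi> = 0" unfolding q_def by (rule inner_Phi_direction)
    moreover have "direction \<xi> \<bullet> direction \<xi> = 1"
      using norm_direction[of \<xi>] by (simp add: norm_eq_1)
    ultimately show ?thesis
      unfolding power2_norm_eq_inner Phi_affine[of \<xi> \<eta> r] q_def[symmetric]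
      by (simp add: inner_add_left inner_add_right inner_commute power2_eq_square)
  qed
  have le: "norm q \<le> norm (Phi ((\<xi>, \<eta>), r))" for r
    by (rule power2_le_imp_le) (simp_all add: n)
  show ?thesis
    unfolding closest_point_def q_def[symmetric]
  proof (rule some_equality)
    show "q \<in> line_points (\<xi>, \<eta>) \<and> (\<forall>y\<in>line_points (\<xi>, \<eta>). dist 0 q \<le> dist 0 y)"
      using le by (auto simp: line_points_def q_def)
  next
    fix x assume x: "x \<in> line_points (\<xi>, \<eta>) \<and> (\<forall>y\<in>line_points (\<xi>, \<eta>). dist 0 x \<le> dist 0 y)"
    then obtain r where r: "x = Phi ((\<xi>, \<eta>), r)" by (auto simp: line_points_def)
    have "norm x \<le> norm q" using x by (auto simp: line_points_def q_def)
    then have "(norm x)\<^sup>2 \<le> (norm q)\<^sup>2" by (simp add: power_mono)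
    then have "r = 0" using n[of r] by (simp add: r)
    then show "x = q" by (simp add: r q_def)
  qed
qed

section \<open>Reflection in homogeneous coordinates\<close>

text \<open>
  The extension of \<open>direction\<close> to the whole sphere: the pair \<open>(a, b)\<close> stands for the coordinate \<open>a / b\<close>, and
  \<open>b = 0\<close> for the south direction. A direction of the patch can be reflected to the south direction,
  so reflection is a total operation only in these coordinates.
\<close>

definition homogeneous_direction :: "complex \<Rightarrow> complex \<Rightarrow> space" where
  "homogeneous_direction a b =
     (2 * a * cnj b / (a * cnj a + b * cnj b), Re ((b * cnj b - a * cnj a) / (a * cnj a + b * cnj b)))"

lemma direction_divide:
  assumes "b \<noteq> 0" shows "direction (a / b) = homogeneous_direction a b"
proof -
  have "1 + a / b * cnj (a / b) = (a * cnj a + b * cnj b) / (b * cnj b)"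
    and "1 - a / b * cnj (a / b) = (b * cnj b - a * cnj a) / (b * cnj b)"
    using assms by (simp_all add: field_simps)
  then show ?thesis unfolding direction_def homogeneous_direction_def using assms by simp
qed

lemma homogeneous_direction_south:
  assumes "a \<noteq> 0" shows "homogeneous_direction a 0 = (0, - 1)"
  using assms by (simp add: homogeneous_direction_def)

lemma reflect_reflect:
  assumes "norm n = 1" shows "reflect n (reflect n v) = v"
  using assms by (simp add: reflect_def norm_eq_1 inner_diff_left)

text \<open>
  \<open>X\<close> and \<open>Y\<close> stand for the conjugates of \<open>x\<close> and \<open>y\<close>, \<open>A\<close> and \<open>B\<close> for those of \<open>a\<close> and \<open>b\<close>, and \<open>m\<close> is the inner
  product of the two directions. The third identity shows that \<open>a\<close> and \<open>b\<close> never vanish together.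
\<close>

lemma reflect_direction_algebra:
  fixes x X y Y :: complex
  assumes "1 + x * X \<noteq> 0" "1 + y * Y \<noteq> 0"
  defines "a \<equiv> 2 * x * Y + 1 - x * X" and "A \<equiv> 2 * X * y + 1 - x * X"
    and "b \<equiv> (1 - x * X) * Y - 2 * X" and "B \<equiv> (1 - x * X) * y - 2 * x"
    and "m \<equiv> (X * (2 * y / (1 + y * Y)) + x * (2 * Y / (1 + y * Y))
               + (1 - x * X) * ((1 - y * Y) / (1 + y * Y))) / (1 + x * X)"
  shows "2 * y / (1 + y * Y) - 2 * m * (2 * x / (1 + x * X)) = 2 * a * B / (a * A + b * B)"
    and "(1 - y * Y) / (1 + y * Y) - 2 * m * ((1 - x * X) / (1 + x * X)) = (b * B - a * A) / (a * A + b * B)"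
    and "a * A + b * B = (1 + x * X)\<^sup>2 * (1 + y * Y)"
proof -
  define P Q where "P = 1 + x * X" and "Q = 1 + y * Y"
  have PQ: "P \<noteq> 0" "Q \<noteq> 0" using assms(1,2) by (simp_all add: P_def Q_def)
  show D: "a * A + b * B = (1 + x * X)\<^sup>2 * (1 + y * Y)"
    unfolding a_def A_def b_def B_def by algebra
  define h k where "h = 2 * y / Q" and "k = 2 * x / P"
  define h' k' where "h' = (1 - y * Y) / Q" and "k' = (1 - x * X) / P"
  have M: "m * P * Q = X * (2 * y) + x * (2 * Y) + (1 - x * X) * (1 - y * Y)"
    using PQ unfolding m_def P_def[symmetric] Q_def[symmetric] by (simp add: field_simps)
  have H: "h * Q = 2 * y" "k * P = 2 * x" "h' * Q = 1 - y * Y" "k' * P = 1 - x * X"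
    using PQ by (simp_all add: h_def k_def h'_def k'_def)
  have "(h - 2 * m * k) * (P\<^sup>2 * Q) = 2 * a * B"
    using M H P_def Q_def a_def B_def by algebra
  then show "2 * y / (1 + y * Y) - 2 * m * (2 * x / (1 + x * X)) = 2 * a * B / (a * A + b * B)"
    unfolding D P_def[symmetric] Q_def[symmetric] h_def[symmetric] k_def[symmetric]
    using PQ by (simp add: eq_divide_eq)
  have "(h' - 2 * m * k') * (P\<^sup>2 * Q) = b * B - a * A"
    using M H P_def Q_def a_def B_def b_def A_def by algebra
  then show "(1 - y * Y) / (1 + y * Y) - 2 * m * ((1 - x * X) / (1 + x * X)) = (b * B - a * A) / (a * A + b * B)"
    unfolding D P_def[symmetric] Q_def[symmetric] h'_def[symmetric] k'_def[symmetric]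
    using PQ by (simp add: eq_divide_eq)
qed

lemma reflect_direction:
  "reflect (direction x) (direction y) = homogeneous_direction
     (2 * x * cnj y + 1 - x * cnj x) ((1 - x * cnj x) * cnj y - 2 * cnj x)"
proof -
  define m where "m = direction y \<bullet> direction x"
  note d = one_plus_cnj_nonzero[of x] one_plus_cnj_nonzero[of y]
  note M = of_real_inner_directions[of y x, folded m_def]
  have c: "cnj (2 * x * cnj y + 1 - x * cnj x) = 2 * cnj x * y + 1 - x * cnj x"
    "cnj ((1 - x * cnj x) * cnj y - 2 * cnj x) = (1 - x * cnj x) * y - 2 * x"
    by (simp_all add: mult.commute)
  have "fst (reflect (direction x) (direction y)) = fst (direction y) - 2 * of_real m * fst (direction x)"
    by (simp add: reflect_def m_def scaleR_conv_of_real)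
  also have "\<dots> = 2 * y / (1 + y * cnj y) - 2 * of_real m * (2 * x / (1 + x * cnj x))"
    by (simp add: direction_def)
  finally have 1: "fst (reflect (direction x) (direction y)) = \<dots>" .
  have "complex_of_real (snd (reflect (direction x) (direction y)))
      = of_real (snd (direction y)) - 2 * of_real m * of_real (snd (direction x))"
    by (simp add: reflect_def m_def)
  then have 2: "snd (reflect (direction x) (direction y))
      = Re ((1 - y * cnj y) / (1 + y * cnj y) - 2 * of_real m * ((1 - x * cnj x) / (1 + x * cnj x)))"
    unfolding of_real_snd_direction by (metis Re_complex_of_real)
  show ?thesis
    unfolding prod_eq_iff 1 2 M reflect_direction_algebra(1,2)[OF d] homogeneous_direction_def c fst_conv snd_conv
    by simp
qed

text \<open>
  Reflection is an involution, so the incoming direction is the reflection of the outgoing one. A zero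
  denominator would make it the south direction, which has no coordinate.
\<close>

lemma direction_reflect_iff:
  fixes x y w :: complex
  defines "a \<equiv> 2 * x * cnj y + 1 - x * cnj x" and "b \<equiv> (1 - x * cnj x) * cnj y - 2 * cnj x"
  shows "direction y = reflect (direction x) (direction w) \<longleftrightarrow> b \<noteq> 0 \<and> w = a / b"
proof -
  have c: "cnj a = 2 * cnj x * y + 1 - x * cnj x" "cnj b = (1 - x * cnj x) * y - 2 * x"
    by (simp_all add: a_def b_def mult.commute)
  have "a * cnj a + b * cnj b \<noteq> 0"
    unfolding c unfolding a_def b_def reflect_direction_algebra(3)[OF one_plus_cnj_nonzero one_plus_cnj_nonzero]
    using one_plus_cnj_nonzero[of x] one_plus_cnj_nonzero[of y] by simp
  then have nz: "a \<noteq> 0" if "b = 0" using that by auto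
  have "direction y = reflect (direction x) (direction w)
      \<longleftrightarrow> direction w = reflect (direction x) (direction y)"
    using reflect_reflect[OF norm_direction] by metis
  also have "\<dots> \<longleftrightarrow> direction w = homogeneous_direction a b"
    by (simp only: reflect_direction a_def b_def)
  also have "\<dots> \<longleftrightarrow> b \<noteq> 0 \<and> w = a / b"
  proof (cases "b = 0")
    case True
    then show ?thesis using nz homogeneous_direction_south direction_neq_south by auto
  next
    case False
    then show ?thesis using inj_direction by (simp add: direction_divide[symmetric] inj_eq)
  qed
  finally show ?thesis .
qed

text \<open>
  The chordal distance on the sphere, obtained from \<open>\<bar>u - v\<bar>\<^sup>2 = 2 - 2 (u \<bullet> v)\<close> for unit vectors.
\<close>

lemma norm_direction_diff:
  "norm (direction x - direction y) = 2 * cmod (x - y) / sqrt ((1 + (cmod x)\<^sup>2) * (1 + (cmod y)\<^sup>2))"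
proof -
  note d = one_plus_cnj_nonzero[of x] one_plus_cnj_nonzero[of y]
  have "complex_of_real (direction y \<bullet> direction x) * ((1 + x * cnj x) * (1 + y * cnj y))
      = 2 * cnj x * y + 2 * x * cnj y + (1 - x * cnj x) * (1 - y * cnj y)"
    unfolding of_real_inner_directions using d by (simp add: divide_simps)
  then have "(2 - 2 * complex_of_real (direction y \<bullet> direction x)) * ((1 + x * cnj x) * (1 + y * cnj y))
      = 4 * ((x - y) * cnj (x - y))"
    unfolding complex_cnj_diff by algebra
  then have "complex_of_real ((2 - 2 * (direction y \<bullet> direction x)) * ((1 + (cmod x)\<^sup>2) * (1 + (cmod y)\<^sup>2)))
      = complex_of_real (4 * (cmod (x - y))\<^sup>2)"
    by (simp only: of_real_mult of_real_diff of_real_add of_real_1 of_real_numeral complex_norm_square)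
  then have "(2 - 2 * (direction y \<bullet> direction x)) * ((1 + (cmod x)\<^sup>2) * (1 + (cmod y)\<^sup>2))
      = 4 * (cmod (x - y))\<^sup>2"
    by (simp only: of_real_eq_iff)
  moreover have "(1 + (cmod x)\<^sup>2) * (1 + (cmod y)\<^sup>2) > 0"
    by (simp add: add_pos_nonneg)
  ultimately have e: "2 - 2 * (direction y \<bullet> direction x)
      = 4 * (cmod (x - y))\<^sup>2 / ((1 + (cmod x)\<^sup>2) * (1 + (cmod y)\<^sup>2))"
    by (metis less_numeral_extra(3) nonzero_eq_divide_eq)
  have "(norm (direction x - direction y))\<^sup>2 = 2 - 2 * (direction y \<bullet> direction x)"
    using norm_direction[of x] norm_direction[of y]
    by (simp add: power2_norm_eq_inner norm_eq_1 inner_diff_left inner_diff_right inner_commute)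
  then have "norm (direction x - direction y)
      = sqrt (4 * (cmod (x - y))\<^sup>2 / ((1 + (cmod x)\<^sup>2) * (1 + (cmod y)\<^sup>2)))"
    unfolding e by (metis norm_ge_zero real_sqrt_unique)
  then show ?thesis by (simp add: real_sqrt_divide real_sqrt_mult)
qed

section \<open>Normal lines and the length of a reflected ray\<close>

text \<open>
  The normal determines \<open>\<xi>\<close>, and \<open>\<xi>\<close> together with the point determines \<open>\<eta>\<close> and \<open>r\<close>; so the definite
  description has exactly one candidate.
\<close>

lemma Phi_S_inv_iff:
  assumes "norm (N p) = 1" and "N p \<noteq> (0, - 1)"
  shows "Phi_S_inv N p = ((\<xi>, \<eta>), r) \<longleftrightarrow> direction \<xi> = N p \<and> Phi ((\<xi>, \<eta>), r) = p"
proof -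
  obtain \<zeta> where \<zeta>: "direction \<zeta> = N p"
    using direction_exhausts_unit_vectors assms by blast
  define x where "x = ((\<zeta>, line_coordinate \<zeta> p), p \<bullet> direction \<zeta>)"
  have u: "y = x" if "direction (fst (fst y)) = N p \<and> Phi y = p" for y
  proof -
    obtain \<xi>' \<eta>' r' where y: "y = ((\<xi>', \<eta>'), r')" by (metis surj_pair)
    have "\<xi>' = \<zeta>" using that \<zeta> injD[OF inj_direction] by (simp add: y)
    then show ?thesis
      using that line_coordinate_Phi[of \<xi>' \<eta>' r'] inner_Phi_direction[of \<xi>' \<eta>' r']
      by (simp add: x_def y)
  qed
  have x: "direction (fst (fst x)) = N p \<and> Phi x = p"
    using Phi_coordinates[of \<zeta> p] by (simp add: x_def \<zeta>)
  have "Phi_S_inv N p = x"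
    unfolding Phi_S_inv_def using x u by (rule the_equality)
  then show ?thesis using x u[of "((\<xi>, \<eta>), r)"] by auto
qed

text \<open>
  The two sides of the equation that selects the points of reflection, as multiples of the coordinate
  \<open>\<eta>\<close> of the lines through \<open>p1\<close> and through the point on the surface.
\<close>

lemma line_coordinate_divide:
  assumes "b \<noteq> 0"
  shows "z * b\<^sup>2 - 2 * of_real t * b * a - cnj z * a\<^sup>2 = 2 * b\<^sup>2 * line_coordinate (a / b) (z, t)"
  using assms by (simp add: line_coordinate_def field_simps power2_eq_square)

lemma line_coordinate_divide_Phi:
  fixes x y e :: complex and r :: real
  defines "a \<equiv> 2 * x * cnj y + 1 - x * cnj x" and "b \<equiv> (1 - x * cnj x) * cnj y - 2 * cnj x"
  assumes "b \<noteq> 0"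
  shows "2 * b\<^sup>2 * line_coordinate (a / b) (Phi ((x, e), r))
    = 2 * ((cnj x - cnj y)\<^sup>2 * e - (1 + x * cnj y)\<^sup>2 * cnj e
           + (cnj x - cnj y) * (1 + x * cnj y) * (1 + x * cnj x) * of_real r)"
proof -
  define z t where "z = fst (Phi ((x, e), r))" and "t = snd (Phi ((x, e), r))"
  have "2 * b\<^sup>2 * line_coordinate (a / b) (z, t) = z * b\<^sup>2 - 2 * of_real t * b * a - cnj z * a\<^sup>2"
    using line_coordinate_divide[OF assms(3)] by simp
  also have "\<dots> = 2 * ((cnj x - cnj y)\<^sup>2 * e - (1 + x * cnj y)\<^sup>2 * cnj e
           + (cnj x - cnj y) * (1 + x * cnj y) * (1 + x * cnj x) * of_real r)"
    unfolding z_def t_def of_real_snd_Phi cnj_fst_Phi unfolding Phi.simps fst_conv a_def b_def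
    by (rule Phi_inverse_algebra(3)[OF one_plus_cnj_nonzero])
  finally show ?thesis by (simp only: z_def t_def prod.collapse)
qed

text \<open>
  The sign of \<open>v1 \<bullet> n\<close> makes \<open>v1 - v2\<close> equal to \<open>- \<bar>v1 - v2\<bar> n\<close>, so \<open>p\<close> enters the length of the path only
  through its component along the normal.
\<close>

lemma path_length_by_reflection:
  assumes "norm n = 1" and "v1 \<bullet> n \<le> 0" and "v2 = reflect n v1" and "q \<bullet> v2 = 0"
  shows "ray_distance v1 p1 p + ray_distance v2 p q = - (p1 \<bullet> v1 + norm (v1 - v2) * (p \<bullet> n))"
proof -
  have "v1 - v2 = (2 * (v1 \<bullet> n)) *\<^sub>R n" by (simp add: assms(3) reflect_def)
  then have "norm (v1 - v2) = - 2 * (v1 \<bullet> n)" and "p \<bullet> v1 - p \<bullet> v2 = 2 * (v1 \<bullet> n) * (p \<bullet> n)"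
    using assms(1,2) by (simp_all flip: inner_diff_right)
  then show ?thesis
    using assms(4) by (simp add: ray_distance_def inner_diff_left)
qed

section \<open>Hamilton's mixed characteristic function\<close>

theorem theorem4:
  fixes S :: "space set" and N :: "space \<Rightarrow> space" and M :: "complex set"
    and \<xi>0 \<eta>0 :: "complex \<Rightarrow> complex" and r0 :: "complex \<Rightarrow> real"
    and z1 :: complex and t1 :: real and \<xi>2 :: complex
  assumes surface: "oriented_C1_surface S N"
    and patch: "\<And>p. p \<in> S \<Longrightarrow> N p \<noteq> (0, -1)"
    and congruence: "parameterizes_normal_congruence S N M \<xi>0 \<eta>0 r0"
  shows
    "let num = (\<lambda>\<mu>. 2 * \<xi>0 \<mu> * cnj \<xi>2 + 1 - \<xi>0 \<mu> * cnj (\<xi>0 \<mu>));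
         den = (\<lambda>\<mu>. (1 - \<xi>0 \<mu> * cnj (\<xi>0 \<mu>)) * cnj \<xi>2 - 2 * cnj (\<xi>0 \<mu>));
         \<xi>1 = (\<lambda>\<mu>. num \<mu> / den \<mu>);
         solutions = {\<mu> \<in> M. den \<mu> \<noteq> 0 \<and>
           direction (\<xi>1 \<mu>) \<bullet> direction (\<xi>0 \<mu>) \<le> 0 \<and>
           z1 * (den \<mu>)\<^sup>2 - 2 * of_real t1 * den \<mu> * num \<mu> - cnj z1 * (num \<mu>)\<^sup>2
             = 2 * ((cnj (\<xi>0 \<mu>) - cnj \<xi>2)\<^sup>2 * \<eta>0 \<mu> - (1 + \<xi>0 \<mu> * cnj \<xi>2)\<^sup>2 * cnj (\<eta>0 \<mu>)
                 + (cnj (\<xi>0 \<mu>) - cnj \<xi>2) * (1 + \<xi>0 \<mu> * cnj \<xi>2) * (1 + \<xi>0 \<mu> * cnj (\<xi>0 \<mu>))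
                     * of_real (r0 \<mu>))};
         value_at = (\<lambda>\<mu>. cmod (
           (cnj (\<xi>1 \<mu>) * z1 + \<xi>1 \<mu> * cnj z1 + (1 - \<xi>1 \<mu> * cnj (\<xi>1 \<mu>)) * of_real t1)
               / (1 + \<xi>1 \<mu> * cnj (\<xi>1 \<mu>))
           + of_real (2 * cmod (\<xi>1 \<mu> - \<xi>2) / sqrt ((1 + (cmod (\<xi>1 \<mu>))\<^sup>2) * (1 + (cmod \<xi>2)\<^sup>2))
               * r0 \<mu>)));
         W = mixed_characteristic S N (z1, t1) \<xi>2
     in (\<forall>w\<in>W. \<exists>\<mu>\<in>solutions. w = value_at \<mu> \<or> w = - value_at \<mu>)
      \<and> (\<forall>\<mu>\<in>solutions. value_at \<mu> \<in> W \<or> - value_at \<mu> \<in> W)"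
proof -
  define num where "num = (\<lambda>\<mu>. 2 * \<xi>0 \<mu> * cnj \<xi>2 + 1 - \<xi>0 \<mu> * cnj (\<xi>0 \<mu>))"
  define den where "den = (\<lambda>\<mu>. (1 - \<xi>0 \<mu> * cnj (\<xi>0 \<mu>)) * cnj \<xi>2 - 2 * cnj (\<xi>0 \<mu>))"
  define \<xi>1 where "\<xi>1 = (\<lambda>\<mu>. num \<mu> / den \<mu>)"
  define solutions where "solutions = {\<mu> \<in> M. den \<mu> \<noteq> 0 \<and>
           direction (\<xi>1 \<mu>) \<bullet> direction (\<xi>0 \<mu>) \<le> 0 \<and>
           z1 * (den \<mu>)\<^sup>2 - 2 * of_real t1 * den \<mu> * num \<mu> - cnj z1 * (num \<mu>)\<^sup>2
             = 2 * ((cnj (\<xi>0 \<mu>) - cnj \<xi>2)\<^sup>2 * \<eta>0 \<mu> - (1 + \<xi>0 \<mu> * cnj \<xi>2)\<^sup>2 * cnj (\<eta>0 \<mu>)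
                 + (cnj (\<xi>0 \<mu>) - cnj \<xi>2) * (1 + \<xi>0 \<mu> * cnj \<xi>2) * (1 + \<xi>0 \<mu> * cnj (\<xi>0 \<mu>))
                     * of_real (r0 \<mu>))}"
  define value_at where "value_at = (\<lambda>\<mu>. cmod (
           (cnj (\<xi>1 \<mu>) * z1 + \<xi>1 \<mu> * cnj z1 + (1 - \<xi>1 \<mu> * cnj (\<xi>1 \<mu>)) * of_real t1)
               / (1 + \<xi>1 \<mu> * cnj (\<xi>1 \<mu>))
           + of_real (2 * cmod (\<xi>1 \<mu> - \<xi>2) / sqrt ((1 + (cmod (\<xi>1 \<mu>))\<^sup>2) * (1 + (cmod \<xi>2)\<^sup>2))
               * r0 \<mu>)))"
  \<comment> \<open>The signed length of the path over the point \<open>foot \<mu>\<close> of the surface; \<open>value_at \<mu>\<close> is its absolute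
      value.\<close>
  define path where "path = (\<lambda>\<mu>. - ((z1, t1) \<bullet> direction (\<xi>1 \<mu>)
      + norm (direction (\<xi>1 \<mu>) - direction \<xi>2) * r0 \<mu>))"
  define foot where "foot = (\<lambda>\<mu>. Phi ((\<xi>0 \<mu>, \<eta>0 \<mu>), r0 \<mu>))"

  have unit: "norm (N p) = 1" if "p \<in> S" for p
    using surface that by (simp add: oriented_C1_surface_def)
  have image: "(\<lambda>\<mu>. ((\<xi>0 \<mu>, \<eta>0 \<mu>), r0 \<mu>)) ` M = Phi_S_inv N ` S"
    using congruence by (simp add: parameterizes_normal_congruence_def)
  have inv_iff: "Phi_S_inv N p = ((\<xi>, \<eta>), r) \<longleftrightarrow> direction \<xi> = N p \<and> Phi ((\<xi>, \<eta>), r) = p"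
    if "p \<in> S" for p \<xi> \<eta> r
    using unit[OF that] patch[OF that] by (rule Phi_S_inv_iff)
  \<comment> \<open>The congruence lists the lines normal to \<open>S\<close> with the points on them, so the feet are exactly the
      points of \<open>S\<close>.\<close>
  have foot_in: "foot \<mu> \<in> S \<and> N (foot \<mu>) = direction (\<xi>0 \<mu>)" if "\<mu> \<in> M" for \<mu>
  proof -
    have "((\<xi>0 \<mu>, \<eta>0 \<mu>), r0 \<mu>) \<in> Phi_S_inv N ` S" using image that by blast
    then obtain p where "p \<in> S" "Phi_S_inv N p = ((\<xi>0 \<mu>, \<eta>0 \<mu>), r0 \<mu>)" by force
    then have "direction (\<xi>0 \<mu>) = N p" "foot \<mu> = p" unfolding foot_def using inv_iff by blast+
    with \<open>p \<in> S\<close> show ?thesis by simp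
  qed
  have foot_onto: "\<exists>\<mu>\<in>M. foot \<mu> = p" if "p \<in> S" for p
  proof -
    have "Phi_S_inv N p \<in> (\<lambda>\<mu>. ((\<xi>0 \<mu>, \<eta>0 \<mu>), r0 \<mu>)) ` M"
      unfolding image using that by (rule imageI)
    then obtain \<mu> where "\<mu> \<in> M" "Phi_S_inv N p = ((\<xi>0 \<mu>, \<eta>0 \<mu>), r0 \<mu>)" by blast
    then have "foot \<mu> = p" unfolding foot_def using inv_iff[OF that] by blast
    with \<open>\<mu> \<in> M\<close> show ?thesis by blast
  qed
  have reflection: "direction \<xi>2 = reflect (direction (\<xi>0 \<mu>)) (direction w) \<longleftrightarrow> den \<mu> \<noteq> 0 \<and> w = \<xi>1 \<mu>"
    for \<mu> w
    unfolding \<xi>1_def num_def den_def by (rule direction_reflect_iff)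
  \<comment> \<open>The stated equation says that \<open>p1\<close> and the foot lie on a common line of direction \<open>\<xi>1 \<mu>\<close>.\<close>
  have solutions_iff: "\<mu> \<in> solutions \<longleftrightarrow> \<mu> \<in> M \<and> den \<mu> \<noteq> 0 \<and> direction (\<xi>1 \<mu>) \<bullet> direction (\<xi>0 \<mu>) \<le> 0
      \<and> line_coordinate (\<xi>1 \<mu>) (z1, t1) = line_coordinate (\<xi>1 \<mu>) (foot \<mu>)" for \<mu>
  proof (cases "den \<mu> = 0")
    case False
    have "2 * (den \<mu>)\<^sup>2 * line_coordinate (\<xi>1 \<mu>) (foot \<mu>)
      = 2 * ((cnj (\<xi>0 \<mu>) - cnj \<xi>2)\<^sup>2 * \<eta>0 \<mu> - (1 + \<xi>0 \<mu> * cnj \<xi>2)\<^sup>2 * cnj (\<eta>0 \<mu>)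
            + (cnj (\<xi>0 \<mu>) - cnj \<xi>2) * (1 + \<xi>0 \<mu> * cnj \<xi>2) * (1 + \<xi>0 \<mu> * cnj (\<xi>0 \<mu>)) * of_real (r0 \<mu>))"
      using False unfolding \<xi>1_def num_def den_def foot_def by (rule line_coordinate_divide_Phi)
    moreover have "z1 * (den \<mu>)\<^sup>2 - 2 * of_real t1 * den \<mu> * num \<mu> - cnj z1 * (num \<mu>)\<^sup>2
      = 2 * (den \<mu>)\<^sup>2 * line_coordinate (\<xi>1 \<mu>) (z1, t1)"
      unfolding \<xi>1_def by (rule line_coordinate_divide[OF False])
    ultimately show ?thesis
      unfolding solutions_def mem_Collect_eq using False
      by (metis (no_types, lifting) mult_cancel_left mult_eq_0_iff power_eq_0_iff zero_neq_numeral)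
  qed (simp add: solutions_def)

  have value_path: "value_at \<mu> = \<bar>path \<mu>\<bar>" for \<mu>
  proof -
    have "value_at \<mu> = cmod (of_real ((z1, t1) \<bullet> direction (\<xi>1 \<mu>))
        + of_real (norm (direction (\<xi>1 \<mu>) - direction \<xi>2) * r0 \<mu>))"
      unfolding value_at_def of_real_inner_direction norm_direction_diff by simp
    then show ?thesis
      unfolding path_def by (simp only: abs_minus_cancel norm_of_real flip: of_real_add)
  qed
  have ray_length: "ray_distance (direction (\<xi>1 \<mu>)) (z1, t1) (foot \<mu>)
      + ray_distance (direction \<xi>2) (foot \<mu>) (closest_point (line_points (\<xi>2, \<eta>2)) 0) = path \<mu>"
    if "den \<mu> \<noteq> 0" "direction (\<xi>1 \<mu>) \<bullet> direction (\<xi>0 \<mu>) \<le> 0" for \<mu> \<eta>2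
  proof -
    have "direction \<xi>2 = reflect (direction (\<xi>0 \<mu>)) (direction (\<xi>1 \<mu>))"
      using reflection that(1) by blast
    moreover have "closest_point (line_points (\<xi>2, \<eta>2)) 0 \<bullet> direction \<xi>2 = 0"
      unfolding closest_point_line_points by (rule inner_Phi_direction)
    moreover have "foot \<mu> \<bullet> direction (\<xi>0 \<mu>) = r0 \<mu>"
      unfolding foot_def by (rule inner_Phi_direction)
    ultimately show ?thesis
      using path_length_by_reflection[OF norm_direction that(2)] by (simp add: path_def)
  qed

  \<comment> \<open>Both inclusions pass between a ray and the parameter of its point of reflection; given the
      parameter, the lines of directions \<open>\<xi>1 \<mu>\<close> and \<open>\<xi>2\<close> through the foot are the two parts of the ray.\<close>
  have W_eq: "mixed_characteristic S N (z1, t1) \<xi>2 = path ` solutions"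
  proof (intro equalityI subsetI)
    fix w assume "w \<in> mixed_characteristic S N (z1, t1) \<xi>2"
    then obtain \<zeta> \<eta>1 \<eta>2 p where w: "w = ray_distance (direction \<zeta>) (z1, t1) p
        + ray_distance (direction \<xi>2) p (closest_point (line_points (\<xi>2, \<eta>2)) 0)"
      and p1: "(z1, t1) \<in> line_points (\<zeta>, \<eta>1)"
      and refl: "reflected_in S N (\<zeta>, \<eta>1) p (\<xi>2, \<eta>2)"
      unfolding mixed_characteristic_def by blast
    have p: "p \<in> S" "p \<in> line_points (\<zeta>, \<eta>1)" "direction \<zeta> \<bullet> N p \<le> 0"
      "direction \<xi>2 = reflect (N p) (direction \<zeta>)"
      using refl by (simp_all add: reflected_in_def)
    obtain \<mu> where \<mu>: "\<mu> \<in> M" "foot \<mu> = p" using foot_onto p(1) by blast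
    then have n: "N p = direction (\<xi>0 \<mu>)" using foot_in by blast
    have "den \<mu> \<noteq> 0" and \<zeta>: "\<zeta> = \<xi>1 \<mu>" using p(4) reflection unfolding n by blast+
    moreover have "line_coordinate \<zeta> (z1, t1) = line_coordinate \<zeta> p"
      using p1 p(2) by (simp add: in_line_points_iff)
    ultimately have "\<mu> \<in> solutions" using \<mu> p(3) n by (simp add: solutions_iff)
    moreover have "w = path \<mu>"
      using ray_length[of \<mu> \<eta>2] \<open>den \<mu> \<noteq> 0\<close> p(3) by (simp add: w \<zeta> n \<mu>(2))
    ultimately show "w \<in> path ` solutions" by blast
  next
    fix w assume "w \<in> path ` solutions"
    then obtain \<mu> where w: "w = path \<mu>" and "\<mu> \<in> solutions" by blast
    then have \<mu>: "\<mu> \<in> M" "den \<mu> \<noteq> 0" "direction (\<xi>1 \<mu>) \<bullet> direction (\<xi>0 \<mu>) \<le> 0"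
      "line_coordinate (\<xi>1 \<mu>) (z1, t1) = line_coordinate (\<xi>1 \<mu>) (foot \<mu>)"
      by (simp_all add: solutions_iff)
    define \<eta>1 \<eta>2 where "\<eta>1 = line_coordinate (\<xi>1 \<mu>) (foot \<mu>)" and "\<eta>2 = line_coordinate \<xi>2 (foot \<mu>)"
    have "reflected_in S N (\<xi>1 \<mu>, \<eta>1) (foot \<mu>) (\<xi>2, \<eta>2)"
      using foot_in[OF \<mu>(1)] \<mu>(2,3) reflection[of \<mu> "\<xi>1 \<mu>"]
      by (simp add: reflected_in_def in_line_points_iff \<eta>1_def \<eta>2_def)
    moreover have "(z1, t1) \<in> line_points (\<xi>1 \<mu>, \<eta>1)"
      using \<mu>(4) by (simp add: in_line_points_iff \<eta>1_def)
    ultimately show "w \<in> mixed_characteristic S N (z1, t1) \<xi>2"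
      unfolding mixed_characteristic_def w ray_length[OF \<mu>(2,3), of \<eta>2, symmetric] by blast
  qed
  have "(\<forall>w\<in>path ` solutions. \<exists>\<mu>\<in>solutions. w = value_at \<mu> \<or> w = - value_at \<mu>)
      \<and> (\<forall>\<mu>\<in>solutions. value_at \<mu> \<in> path ` solutions \<or> - value_at \<mu> \<in> path ` solutions)"
  proof (intro conjI ballI)
    fix w assume "w \<in> path ` solutions"
    then obtain \<mu> where "\<mu> \<in> solutions" "w = path \<mu>" by blast
    then show "\<exists>\<mu>\<in>solutions. w = value_at \<mu> \<or> w = - value_at \<mu>"
      by (intro bexI[of _ \<mu>]) (auto simp: value_path abs_if)
  next
    fix \<mu> assume "\<mu> \<in> solutions"
    moreover have "value_at \<mu> = path \<mu> \<or> - value_at \<mu> = path \<mu>"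
      unfolding value_path by (auto simp: abs_if)
    ultimately show "value_at \<mu> \<in> path ` solutions \<or> - value_at \<mu> \<in> path ` solutions"
      by auto
  qed
  then show ?thesis
    unfolding W_eq Let_def solutions_def value_at_def \<xi>1_def num_def den_def .
qed

end
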